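(* There exists a topological space $X$ that is a weak $\lambda$-space and is not a $\Delta_1$-space.
   Context: A topological space $X$ is a weak $\lambda$-space if for every pair of disjoint countable sets $Y,Z\subseteq X$ there exists a set $H\subseteq X$ that is both a $G_\delta$-set and an $F_\sigma$-set in $X$ such that $Y\subseteq H$ and $Z\subseteq X\setminus H$. A family $\{U_n:n\in\omega\}$ of subsets of $X$ is point-finite if for every $x\in X$ the set $\{n\in\omega: x\in U_n\}$ is finite. A space $X$ is a $\Delta_1$-space if for every sequence $\{A_n:n\in\omega\}$ of pairwise disjoint countable subsets of $X$ there exists a point-finite family $\{U_n:n\in\omega\}$ of open subsets of $X$ such that $A_n\subseteq U_n$ for every $n\in\omega$. *)

theory Defs
  imports "HOL-Analysis.Analysis"
begin

definition weak_lambda_space :: "'a topology \<Rightarrow> bool" where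
  "weak_lambda_space X \<longleftrightarrow>
    (\<forall>Y Z. Y \<subseteq> topspace X \<and> Z \<subseteq> topspace X \<and> countable Y \<and> countable Z \<and> Y \<inter> Z = {} \<longrightarrow>
      (\<exists>H. gdelta_in X H \<and> fsigma_in X H \<and> Y \<subseteq> H \<and> Z \<subseteq> topspace X - H))"

(* Finiteness is counted over indices, so a nonempty set may be repeated only finitely often. *)
definition point_finite_in :: "'a topology \<Rightarrow> (nat \<Rightarrow> 'a set) \<Rightarrow> bool" where
  "point_finite_in X U \<longleftrightarrow> (\<forall>x\<in>topspace X. finite {n. x \<in> U n})"

definition Delta1_space :: "'a topology \<Rightarrow> bool" where
  "Delta1_space X \<longleftrightarrow>
    (\<forall>A :: nat \<Rightarrow> 'a set.
      (\<forall>n. A n \<subseteq> topspace X \<and> countable (A n)) \<and> disjoint_family A \<longrightarrow>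
      (\<exists>U. (\<forall>n. openin X (U n)) \<and> point_finite_in X U \<and> (\<forall>n. A n \<subseteq> U n)))"

end

theory Submission
  imports Defs "HOL-Library.Diagonal_Subsequence"
begin

text \<open>
  The space consists of countably many hubs, one for each natural number \<open>n\<close>, and of a large
  set of isolated leaves. A leaf \<open>x\<close> carries a label \<open>label x :: nat set \<Rightarrow> nat\<close>, and
  every function of this type with even values at singletons is the label of a leaf. For a set \<open>E\<close> of naturals
  the leaves are thereby partitioned into the countably many fibres \<open>{x. label x E = k}\<close>. A fibre
  with even \<open>k\<close> accumulates only at hubs outside \<open>E\<close>, and a fibre with odd \<open>k\<close> only at hubs
  in \<open>E\<close>; this is arranged by decreeing that the leaves omitted by a neighbourhood of the hub of
  \<open>n\<close> lie in finitely many fibres, each of the first kind with \<open>n \<in> E\<close> or of the second kind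
  with \<open>n \<notin> E\<close>.

  The space is a weak \<open>\<lambda>\<close>-space, because the partition attached to \<open>E\<close> splits the leaves into two
  halves, \<open>label x E\<close> odd and \<open>label x E\<close> even. The odd half together with the hubs in \<open>E\<close>
  is \<open>F\<^sub>\<sigma>\<close>, and so is its complement. Hence any set of hubs can be separated from the
  other hubs, and countably many leaves can be moved from one side to the other since leaves are
  both closed and isolated (\<open>weak_lambda_hub_space\<close>).

  It is not a \<open>\<Delta>\<^sub>1\<close>-space, because open sets around the singletons of hubs are never
  point-finite. The leaves omitted by such open sets lie in countably many fibres, so only
  countably many sets \<open>E\<close> are involved. Some infinite \<open>N\<close> is, up to finitely many elements,
  contained in or disjoint from each of these \<open>E\<close>. If \<open>N\<close> is almost contained in \<open>E\<close>,
  no fibre with an odd value of \<open>label x E\<close> is among those chosen for a hub in \<open>E\<close>, and the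
  remaining finitely many members of \<open>N\<close> exclude only finitely many values; likewise with even
  values in the other case. So one label avoids the fibres chosen for every hub in \<open>N\<close>, and its
  leaf lies in infinitely many of the open sets (\<open>label_avoiding_omissions\<close>, \<open>not_Delta1_hub_space\<close>).
\<close>

section \<open>Almost deciding countably many sets of naturals\<close>

lemma ex_infinite_almost_deciding:
  fixes \<E> :: "nat set set"
  assumes "countable \<E>"
  obtains N where "infinite N" "\<And>E. E \<in> \<E> \<Longrightarrow> finite (N - E) \<or> finite (N \<inter> E)"
proof (cases "\<E> = {}")
  case True
  then show ?thesis using that[of UNIV] by auto
next
  case False
  define e where "e = from_nat_into \<E>"
  have range_e: "range e = \<E>"
    using assms False by (simp add: e_def)
  define P where "P i s \<longleftrightarrow> (\<forall>n. s n \<in> e i) \<or> (\<forall>n. s n \<notin> e i)" for i and s :: "nat \<Rightarrow> nat"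
  interpret subseqs P
  proof
    fix i and s :: "nat \<Rightarrow> nat"
    have "{n. s n \<in> e i} \<union> {n. s n \<notin> e i} = UNIV"
      by auto
    then have "infinite {n. s n \<in> e i} \<or> infinite {n. s n \<notin> e i}"
      by (metis finite_UnI infinite_UNIV_nat)
    then show "\<exists>r. strict_mono r \<and> P i (s \<circ> r)"
    proof
      assume "infinite {n. s n \<in> e i}"
      then show ?thesis
        using infinite_enumerate[of "{n. s n \<in> e i}"] by (auto simp: P_def)
    next
      assume "infinite {n. s n \<notin> e i}"
      then show ?thesis
        using infinite_enumerate[of "{n. s n \<notin> e i}"] by (auto simp: P_def)
    qed
  qed
  show ?thesis
  proof (rule that[of "range diagseq"])
    show "infinite (range diagseq)"
      using subseq_diagseq range_inj_infinite strict_mono_imp_inj_on by blast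
    fix E assume "E \<in> \<E>"
    then obtain i where i: "E = e i"
      using range_e by auto
    have "P i (diagseq \<circ> (+) (Suc i))"
      by (rule diagseq_holds) (auto simp: P_def)
    then have "(\<forall>j. diagseq (Suc i + j) \<in> E) \<or> (\<forall>j. diagseq (Suc i + j) \<notin> E)"
      by (simp add: P_def i)
    moreover have "n \<le> i \<or> (\<exists>j. n = Suc i + j)" for n
      by presburger
    ultimately have "range diagseq - E \<subseteq> diagseq ` {..i} \<or> range diagseq \<inter> E \<subseteq> diagseq ` {..i}"
      by blast
    then show "finite (range diagseq - E) \<or> finite (range diagseq \<inter> E)"
      by (meson finite_atMost finite_imageI finite_subset)
  qed
qed

section \<open>Hubs and labelled leaves\<close>

text \<open>There are \<open>2^(2^\<aleph>\<^sub>0)\<close> labels, exactly as many as sets of reals. A label is coded by its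
  graph, and the pairs in the graph are coded by reals.\<close>

definition code :: "nat set \<times> nat \<Rightarrow> real" where
  "code = (SOME c. inj c)"

lemma inj_code: "inj code"
proof -
  obtain g :: "nat set \<Rightarrow> real" where g: "inj g" "range g \<subseteq> {0..<1}"
    using nat_sets_lepoll_reals01 unfolding lepoll_def by blast
  have "inj (\<lambda>(E, k). g E + real k)"
  proof (rule injI, clarify)
    fix E E' and k k' :: nat
    assume eq: "g E + real k = g E' + real k'"
    have "g E \<in> {0..<1}" "g E' \<in> {0..<1}"
      using g(2) by blast+
    then have "k = k'"
      using eq by auto
    then show "E = E' \<and> k = k'"
      using eq g(1) by (auto dest: injD)
  qed
  then show ?thesis
    unfolding code_def by (rule someI[where P = inj])
qed

definition label :: "real set \<Rightarrow> nat set \<Rightarrow> nat" where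
  "label x E = (LEAST k. code (E, k) \<in> x)"

definition hub :: "nat \<Rightarrow> real set" where
  "hub n = {real n}"

text \<open>Infinity keeps leaves apart from hubs. Even values at singletons \<open>{n}\<close> allow every
  neighbourhood of the hub of \<open>n\<close> to avoid the fibre of a given leaf, which makes points closed.\<close>

definition leaves :: "real set set" where
  "leaves = {x. infinite x \<and> (\<forall>n. even (label x {n}))}"

lemma hub_eq_iff [simp]: "hub m = hub n \<longleftrightarrow> m = n"
  by (simp add: hub_def)

lemma hub_notin_leaves [simp]: "hub n \<notin> leaves"
  by (simp add: hub_def leaves_def)

lemma ex_leaf_with_label:
  assumes "\<And>n. even (f {n})"
  shows "\<exists>x\<in>leaves. label x = f"
proof -
  define x where "x = range (\<lambda>E. code (E, f E))"
  have "code (E, k) \<in> x \<longleftrightarrow> k = f E" for E k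
    using inj_code by (auto simp: x_def dest: injD)
  then have label: "label x = f"
    by (auto simp: label_def fun_eq_iff intro: Least_equality)
  have "inj (\<lambda>E. code (E, f E))"
    using inj_code by (auto simp: inj_def)
  moreover have "infinite (UNIV :: nat set set)"
    by (simp add: Finite_Set.finite_set)
  ultimately have "infinite x"
    unfolding x_def using finite_imageD by blast
  then show ?thesis
    using label assms by (auto simp: leaves_def)
qed

section \<open>The topology\<close>

definition fibre :: "nat set \<times> nat \<Rightarrow> real set set" where
  "fibre = (\<lambda>(E, k). {x \<in> leaves. label x E = k})"

definition omissible :: "nat \<Rightarrow> (nat set \<times> nat) set" where
  "omissible n = {(E, k). n \<in> E \<longleftrightarrow> even k}"

definition surrounds :: "real set set \<Rightarrow> nat \<Rightarrow> bool" where
  "surrounds U n \<longleftrightarrow> (\<exists>F. finite F \<and> F \<subseteq> omissible n \<and> leaves \<subseteq> U \<union> \<Union> (fibre ` F))"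

definition hub_space :: "real set topology" where
  "hub_space = topology (\<lambda>U. U \<subseteq> range hub \<union> leaves \<and> (\<forall>n. hub n \<in> U \<longrightarrow> surrounds U n))"

lemma surroundsI:
  assumes "finite F" "F \<subseteq> omissible n" "leaves \<subseteq> U \<union> \<Union> (fibre ` F)"
  shows "surrounds U n"
  using assms by (auto simp: surrounds_def)

lemma surrounds_mono: "surrounds U n \<Longrightarrow> U \<subseteq> V \<Longrightarrow> surrounds V n"
  unfolding surrounds_def by blast

lemma surrounds_Int:
  assumes "surrounds U n" "surrounds V n"
  shows "surrounds (U \<inter> V) n"
proof -
  obtain F G where "finite F" "F \<subseteq> omissible n" "leaves \<subseteq> U \<union> \<Union> (fibre ` F)"
    and "finite G" "G \<subseteq> omissible n" "leaves \<subseteq> V \<union> \<Union> (fibre ` G)"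
    using assms unfolding surrounds_def by metis
  then show ?thesis
    by (intro surroundsI[of "F \<union> G"]) auto
qed

lemma openin_hub_space:
  "openin hub_space U \<longleftrightarrow>
    U \<subseteq> range hub \<union> leaves \<and> (\<forall>n. hub n \<in> U \<longrightarrow> surrounds U n)"
proof -
  have "istopology (\<lambda>U. U \<subseteq> range hub \<union> leaves \<and> (\<forall>n. hub n \<in> U \<longrightarrow> surrounds U n))"
    unfolding istopology_def
  proof (intro conjI allI impI; (elim conjE)?)
    fix \<K> n
    assume \<K>: "\<forall>U\<in>\<K>. U \<subseteq> range hub \<union> leaves \<and> (\<forall>n. hub n \<in> U \<longrightarrow> surrounds U n)"
      and "hub n \<in> \<Union> \<K>"
    then show "surrounds (\<Union> \<K>) n"
      by (meson Union_iff Union_upper surrounds_mono)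
  qed (auto intro: surrounds_Int)
  then show ?thesis
    by (simp add: hub_space_def topology_inverse')
qed

lemma topspace_hub_space: "topspace hub_space = range hub \<union> leaves"
proof
  have "openin hub_space (range hub \<union> leaves)"
    by (auto simp: openin_hub_space intro: surroundsI[of "{}"])
  then show "range hub \<union> leaves \<subseteq> topspace hub_space"
    by (rule openin_subset)
qed (use openin_hub_space openin_topspace in blast)

lemma closedin_hub_space:
  "closedin hub_space S \<longleftrightarrow>
    S \<subseteq> range hub \<union> leaves \<and> (\<forall>n. hub n \<notin> S \<longrightarrow> surrounds (leaves - S) n)"
proof -
  have "surrounds (range hub \<union> leaves - S) n \<longleftrightarrow> surrounds (leaves - S) n" for n
    unfolding surrounds_def by blast
  then show ?thesis
    by (auto simp: closedin_def openin_hub_space topspace_hub_space)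
qed

section \<open>Disjoint countable sets are separated\<close>

text \<open>The set of hubs in the union consists of all those at which the fibre can accumulate.\<close>

lemma closedin_fibre_with_hubs:
  "closedin hub_space (hub ` {n. (E, k) \<notin> omissible n} \<union> (fibre (E, k) - W))"
  unfolding closedin_hub_space
proof (intro conjI allI impI)
  fix n assume "hub n \<notin> hub ` {n. (E, k) \<notin> omissible n} \<union> (fibre (E, k) - W)"
  then show "surrounds (leaves - (hub ` {n. (E, k) \<notin> omissible n} \<union> (fibre (E, k) - W))) n"
    by (intro surroundsI[of "{(E, k)}"]) auto
qed (auto simp: fibre_def)

lemma closedin_leaf:
  assumes "x \<in> leaves"
  shows "closedin hub_space {x}"
  unfolding closedin_hub_space
proof (intro conjI allI impI)
  fix n
  show "surrounds (leaves - {x}) n"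
    using assms
    by (intro surroundsI[of "{({n}, label x {n})}"]) (auto simp: omissible_def fibre_def leaves_def)
qed (use assms in auto)

lemma fsigma_in_countable_leaves:
  assumes "countable A" "A \<subseteq> leaves"
  shows "fsigma_in hub_space A"
proof -
  have "fsigma_in hub_space (\<Union> ((\<lambda>x. {x}) ` A))"
    using assms by (intro fsigma_in_Union) (auto intro: closed_imp_fsigma_in closedin_leaf)
  then show ?thesis by simp
qed

text \<open>The indices in \<open>K\<close> all have one parity, so that all these fibres accumulate at the same
  hubs.\<close>

lemma fsigma_in_half:
  assumes "\<And>n k. k \<in> K \<Longrightarrow> (E, k) \<notin> omissible n \<longleftrightarrow> n \<in> D" and "K \<noteq> {}"
  shows "fsigma_in hub_space (hub ` D \<union> ({x \<in> leaves. label x E \<in> K} - W))"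
proof -
  have "hub ` D \<union> ({x \<in> leaves. label x E \<in> K} - W)
      = \<Union> ((\<lambda>k. hub ` {n. (E, k) \<notin> omissible n} \<union> (fibre (E, k) - W)) ` K)"
    using assms by (auto simp: fibre_def)
  also have "fsigma_in hub_space \<dots>"
    by (intro fsigma_in_Union) (auto intro: closed_imp_fsigma_in closedin_fibre_with_hubs)
  finally show ?thesis .
qed

lemma weak_lambda_hub_space: "weak_lambda_space hub_space"
  unfolding weak_lambda_space_def
proof (intro allI impI, elim conjE)
  fix Y Z
  assume Y: "Y \<subseteq> topspace hub_space" "countable Y" and Z: "Z \<subseteq> topspace hub_space" "countable Z"
    and disj: "Y \<inter> Z = {}"
  define E where "E = {n. hub n \<in> Y}"
  define H where "H = hub ` E \<union> ({x \<in> leaves. label x E \<in> Collect odd} - Z) \<union> (Y \<inter> leaves)"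
  define H' where "H' = hub ` (- E) \<union> ({x \<in> leaves. label x E \<in> Collect even} - Y) \<union> (Z \<inter> leaves)"
  have "Collect odd \<noteq> ({} :: nat set)" "Collect even \<noteq> ({} :: nat set)"
    using odd_one even_zero by blast+
  then have "fsigma_in hub_space H" "fsigma_in hub_space H'"
    unfolding H_def H'_def using Y Z
    by (intro fsigma_in_Un fsigma_in_half fsigma_in_countable_leaves; force simp: omissible_def)+
  moreover have "topspace hub_space - H = H'"
    using disj by (auto simp: H_def H'_def topspace_hub_space)
  moreover have "H \<subseteq> topspace hub_space" "Y \<subseteq> H"
    using Y(1) by (auto simp: H_def E_def topspace_hub_space)
  moreover have "Z \<inter> H = {}"
    using disj by (auto simp: H_def E_def)
  ultimately show "\<exists>H. gdelta_in hub_space H \<and> fsigma_in hub_space H \<and> Y \<subseteq> H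
      \<and> Z \<subseteq> topspace hub_space - H"
    using Z(1) by (intro exI[of _ H]) (auto simp: gdelta_in_fsigma_in)
qed

section \<open>Neighbourhoods of hubs are never point-finite\<close>

lemma ex_parity_notin_finite:
  assumes "finite S"
  shows "\<exists>k::nat. k \<notin> S \<and> (odd k \<longleftrightarrow> b)"
proof -
  obtain m where m: "\<And>k. k \<in> S \<Longrightarrow> k < m"
    using assms by (auto simp: finite_nat_set_iff_bounded)
  have "2 * m + (if b then 1 else 0) \<notin> S"
    using m[of "2 * m + (if b then 1 else 0)"] by auto
  then show ?thesis
    by (intro exI[of _ "2 * m + (if b then 1 else 0)"]) auto
qed

text \<open>On an \<open>E\<close> that almost contains \<open>N\<close> the label takes an odd value, which no \<open>n \<in> E\<close> may
  omit; then the finitely many \<open>n \<in> N - E\<close> have to be avoided by the choice of that value.\<close>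

lemma label_avoiding_omissions:
  assumes F: "\<And>n. finite (F n)" "\<And>n. F n \<subseteq> omissible n"
  obtains N f where "infinite N" "\<And>n. even (f {n})" "\<And>n E. n \<in> N \<Longrightarrow> (E, f E) \<notin> F n"
proof -
  define \<E> where "\<E> = (\<Union>n. fst ` F n)"
  have "countable \<E>"
    using F(1) by (auto simp: \<E>_def intro: countable_finite)
  then obtain N where N: "infinite N" "\<And>E. E \<in> \<E> \<Longrightarrow> finite (N - E) \<or> finite (N \<inter> E)"
    using ex_infinite_almost_deciding by blast
  have "\<exists>k. (odd k \<longrightarrow> finite (N - E)) \<and> (\<forall>n\<in>N. (E, k) \<notin> F n)" for E
  proof -
    define S where "S M = (\<Union>n\<in>M. {k. (E, k) \<in> F n})" for M
    have "finite {k. (E, k) \<in> F n}" for n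
      using finite_vimageI[OF F(1)[of n], of "Pair E"] by (simp add: vimage_def inj_def)
    then have fin: "finite (S M)" if "finite M" for M
      using that by (auto simp: S_def)
    consider "finite (N - E)" | "finite (N \<inter> E)" | "E \<notin> \<E>"
      using N(2) by blast
    then show ?thesis
    proof cases
      case 1
      then obtain k where k: "k \<notin> S (N - E)" "odd k"
        using ex_parity_notin_finite[OF fin, of "N - E" True] by auto
      have "(E, k) \<notin> F n" if "n \<in> N" for n
        using k that F(2)[of n] by (auto simp: S_def omissible_def)
      with 1 show ?thesis by auto
    next
      case 2
      then obtain k where k: "k \<notin> S (N \<inter> E)" "even k"
        using ex_parity_notin_finite[OF fin, of "N \<inter> E" False] by auto
      have "(E, k) \<notin> F n" if "n \<in> N" for n
        using k that F(2)[of n] by (auto simp: S_def omissible_def)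
      with k(2) show ?thesis by auto
    next
      case 3
      then have "(E, 0) \<notin> F n" for n
        by (force simp: \<E>_def)
      then show ?thesis by (intro exI[of _ 0]) auto
    qed
  qed
  then obtain f where f: "\<And>E. odd (f E) \<longrightarrow> finite (N - E)" "\<And>E n. n \<in> N \<Longrightarrow> (E, f E) \<notin> F n"
    by metis
  have "even (f {n})" for n
    using f(1)[of "{n}"] N(1) by auto
  then show ?thesis
    using that N(1) f(2) by blast
qed

lemma not_Delta1_hub_space: "\<not> Delta1_space hub_space"
proof
  assume "Delta1_space hub_space"
  then have "(\<forall>n. {hub n} \<subseteq> topspace hub_space \<and> countable {hub n})
      \<and> disjoint_family (\<lambda>n. {hub n}) \<longrightarrow>
    (\<exists>U. (\<forall>n. openin hub_space (U n)) \<and> point_finite_in hub_space U \<and> (\<forall>n. {hub n} \<subseteq> U n))"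
    unfolding Delta1_space_def by (rule spec)
  moreover have "disjoint_family (\<lambda>n. {hub n})"
    by (auto simp: disjoint_family_on_def)
  ultimately have "\<exists>U. (\<forall>n. openin hub_space (U n)) \<and> point_finite_in hub_space U
      \<and> (\<forall>n. {hub n} \<subseteq> U n)"
    by (simp add: topspace_hub_space)
  then obtain U where U: "\<And>n. openin hub_space (U n)" "\<And>n. hub n \<in> U n"
    and pf: "point_finite_in hub_space U"
    by (metis insert_subset)
  have "surrounds (U n) n" for n
    using U[of n] by (simp add: openin_hub_space)
  then obtain F where F: "\<And>n. finite (F n)" "\<And>n. F n \<subseteq> omissible n"
    and cover: "\<And>n. leaves \<subseteq> U n \<union> \<Union> (fibre ` F n)"
    unfolding surrounds_def by metis
  obtain N f where N: "infinite N" and even: "\<And>n. even (f {n})"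
    and f: "\<And>n E. n \<in> N \<Longrightarrow> (E, f E) \<notin> F n"
    using label_avoiding_omissions[OF F] by metis
  obtain x where x: "x \<in> leaves" "label x = f"
    using ex_leaf_with_label[of f] even by blast
  have "x \<in> U n" if "n \<in> N" for n
  proof -
    have "x \<notin> \<Union> (fibre ` F n)"
      using x f[OF that] by (auto simp: fibre_def)
    then show ?thesis
      using cover[of n] x(1) by blast
  qed
  then have "infinite {n. x \<in> U n}"
    using N infinite_super[of N "{n. x \<in> U n}"] by auto
  then show False
    using pf x(1) by (auto simp: point_finite_in_def topspace_hub_space)
qed

theorem theorem2p2:
  shows "\<exists>X :: real set topology. weak_lambda_space X \<and> \<not> Delta1_space X"
  by (intro exI[of _ hub_space] conjI weak_lambda_hub_space not_Delta1_hub_space)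

end
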